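(* Let $\mathfrak{g}$ be an $n$-dimensional Lie algebra over $\mathbb{K}$ with Lie bracket $\mu$, and let $\varphi:\mathfrak{g}\times\mathfrak{g}\to\mathfrak{g}$ be a symmetric bilinear map. Then $\frac12\mu+\varphi$ is the law of a Vinberg algebra if and only if \begin{align*} &4\varphi(\mu(X_2,X_1),X_3)+2\mu(X_1,\varphi(X_2,X_3))+2\varphi(X_1,\mu(X_2,X_3))+4\varphi(X_1,\varphi(X_2,X_3))\\ &-2\mu(X_2,\varphi(X_1,X_3))-2\varphi(X_2,\mu(X_1,X_3))-4\varphi(X_2,\varphi(X_1,X_3))+\mu(\mu(X_2,X_1),X_3)=0 \end{align*} for all $X_1,X_2,X_3\in\mathfrak{g}$.
   Context: $\mathbb{K}$ is an algebraically closed field of characteristic $0$. A bilinear product $\nu$ on a vector space $A$ is the law of a Vinberg algebra (left symmetric algebra) if $\nu(X,\nu(Y,Z))-\nu(Y,\nu(X,Z))=\nu(\nu(X,Y),Z)-\nu(\nu(Y,X),Z)$ for all $X,Y,Z\in A$. The set of such laws in dimension $n$ is denoted $Vinb_n$ in the paper. *)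

theory Defs
  imports Complex_Main "HOL-Computational_Algebra.Polynomial"
begin

text \<open>Vector spaces are given by an additive group type together with a scalar multiplication,
  as in the library locale \<^locale>\<open>vector_space\<close>.\<close>

definition bilinear_map ::
  "('k::field \<Rightarrow> 'a::ab_group_add \<Rightarrow> 'a) \<Rightarrow> ('a \<Rightarrow> 'a \<Rightarrow> 'a) \<Rightarrow> bool" where
  "bilinear_map scale f \<longleftrightarrow>
     (\<forall>x. Vector_Spaces.linear scale scale (\<lambda>y. f x y)) \<and>
     (\<forall>y. Vector_Spaces.linear scale scale (\<lambda>x. f x y))"

locale lie_algebra = vector_space scale
  for scale :: "'k::field \<Rightarrow> 'a::ab_group_add \<Rightarrow> 'a" +
  fixes bracket :: "'a \<Rightarrow> 'a \<Rightarrow> 'a"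
  assumes bilinear: "bilinear_map scale bracket"
    and alternating: "bracket x x = 0"
    and jacobi: "bracket x (bracket y z) + bracket y (bracket z x) + bracket z (bracket x y) = 0"

locale vinberg_algebra = vector_space scale
  for scale :: "'k::field \<Rightarrow> 'a::ab_group_add \<Rightarrow> 'a" +
  fixes prd :: "'a \<Rightarrow> 'a \<Rightarrow> 'a"
  assumes bilinear: "bilinear_map scale prd"
    and left_symmetric:
      "prd x (prd y z) - prd y (prd x z) = prd (prd x y) z - prd (prd y x) z"

end

theory Submission
  imports Defs
begin

text \<open>
  Write \<open>\<nu> = \<mu>/2 + \<phi>\<close>. As \<open>\<mu>\<close> is skew-symmetric and \<open>\<phi>\<close> is symmetric, the commutator of \<open>\<nu>\<close>
  is \<open>\<mu>\<close>. The right-hand side of the left symmetry law is therefore \<open>\<nu> (\<mu> X Y) Z\<close>, which is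
  linear in \<open>\<nu>\<close>. On the left-hand side, the part that is quadratic in \<open>\<mu>\<close> is a quarter of
  \<open>\<mu> X (\<mu> Y Z) - \<mu> Y (\<mu> X Z)\<close>, and the Jacobi identity turns this into \<open>\<mu> (\<mu> X Y) Z\<close>. Hence
  four times the left symmetry defect of \<open>\<nu>\<close> is exactly the expression of the theorem
  (\<open>four_times_defect\<close>). In characteristic zero the factor 4 can be cancelled, so the two
  vanish together; bilinearity of \<open>\<nu>\<close> is automatic.
\<close>

lemma bilinear_map_add_left: "bilinear_map s f \<Longrightarrow> f (x + y) z = f x z + f y z"
  unfolding bilinear_map_def by (metis Vector_Spaces.linear.axioms(3) module_hom.add)

lemma bilinear_map_add_right: "bilinear_map s f \<Longrightarrow> f x (y + z) = f x y + f x z"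
  unfolding bilinear_map_def by (metis Vector_Spaces.linear.axioms(3) module_hom.add)

lemma bilinear_map_scale_left: "bilinear_map s f \<Longrightarrow> f (s c x) y = s c (f x y)"
  unfolding bilinear_map_def by (metis Vector_Spaces.linear.axioms(3) module_hom.scale)

lemma bilinear_map_scale_right: "bilinear_map s f \<Longrightarrow> f x (s c y) = s c (f x y)"
  unfolding bilinear_map_def by (metis Vector_Spaces.linear.axioms(3) module_hom.scale)

lemma bilinear_map_diff_left: "bilinear_map s f \<Longrightarrow> f (x - y) z = f x z - f y z"
  by (metis add_diff_cancel bilinear_map_add_left diff_add_cancel)

lemma bilinear_map_minus_left:
  assumes "bilinear_map s f"
  shows "f (- x) y = - f x y"
  using bilinear_map_diff_left[OF assms, of 0 x y] bilinear_map_diff_left[OF assms, of 0 0 y]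
  by simp

lemma bilinear_map_minus_right:
  assumes "bilinear_map s f"
  shows "f x (- y) = - f x y"
  using bilinear_map_add_right[OF assms, of x y "- y"] bilinear_map_add_right[OF assms, of x 0 0]
  by (simp add: eq_neg_iff_add_eq_0 add.commute)

lemmas bilinear_map_simps =
  bilinear_map_add_left bilinear_map_add_right bilinear_map_scale_left bilinear_map_scale_right

lemma (in vector_space) bilinear_map_scale_add:
  assumes "bilinear_map scale f" and "bilinear_map scale g"
  shows "bilinear_map scale (\<lambda>x y. scale c (f x y) + g x y)"
  unfolding bilinear_map_def
proof (intro conjI allI)
  fix x
  show "Vector_Spaces.linear scale scale (\<lambda>y. scale c (f x y) + g x y)"
    by unfold_locales
      (simp_all add: bilinear_map_simps[OF assms(1)] bilinear_map_simps[OF assms(2)]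
        scale_right_distrib mult.commute)
next
  fix y
  show "Vector_Spaces.linear scale scale (\<lambda>x. scale c (f x y) + g x y)"
    by unfold_locales
      (simp_all add: bilinear_map_simps[OF assms(1)] bilinear_map_simps[OF assms(2)]
        scale_right_distrib mult.commute)
qed

context lie_algebra
begin

lemma bracket_skew: "bracket y x = - bracket x y"
proof -
  have "bracket x y + bracket y x = bracket (x + y) (x + y)"
    unfolding bilinear_map_add_left[OF bilinear] bilinear_map_add_right[OF bilinear]
    by (simp add: alternating)
  then have "bracket x y + bracket y x = 0"
    by (simp only: alternating)
  then show ?thesis
    by (metis eq_neg_iff_add_eq_0 add.commute)
qed

text \<open>The Jacobi identity, read as saying that the adjoint map \<open>x \<mapsto> bracket x\<close> is a Lie algebra
  representation: in this form its left-hand side has the shape of that of the left symmetry law.\<close>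

lemma jacobi_adjoint:
  "bracket x (bracket y z) - bracket y (bracket x z) = bracket (bracket x y) z"
proof -
  have "bracket y (bracket z x) = - bracket y (bracket x z)"
    by (metis bracket_skew bilinear_map_minus_right[OF bilinear])
  moreover have "bracket z (bracket x y) = - bracket (bracket x y) z"
    by (rule bracket_skew)
  ultimately show ?thesis
    using jacobi[of x y z] by simp
qed

end

lemma four_times_defect:
  fixes scale :: "'k::field_char_0 \<Rightarrow> 'a::ab_group_add \<Rightarrow> 'a" (infixr \<open>\<cdot>\<close> 75)
  assumes lie: "lie_algebra scale \<mu>"
    and bil: "bilinear_map scale \<phi>"
    and sym: "\<And>X Y. \<phi> X Y = \<phi> Y X"
    and \<nu>: "\<And>X Y. \<nu> X Y = (1/2) \<cdot> \<mu> X Y + \<phi> X Y"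
  shows "4 \<cdot> ((\<nu> X (\<nu> Y Z) - \<nu> Y (\<nu> X Z)) - (\<nu> (\<nu> X Y) Z - \<nu> (\<nu> Y X) Z)) =
        4 \<cdot> \<phi> (\<mu> Y X) Z + 2 \<cdot> \<mu> X (\<phi> Y Z) + 2 \<cdot> \<phi> X (\<mu> Y Z)
      + 4 \<cdot> \<phi> X (\<phi> Y Z) - 2 \<cdot> \<mu> Y (\<phi> X Z) - 2 \<cdot> \<phi> Y (\<mu> X Z)
      - 4 \<cdot> \<phi> Y (\<phi> X Z) + \<mu> (\<mu> Y X) Z"
proof -
  interpret lie_algebra scale \<mu> by (rule lie)
  have bil_\<nu>: "bilinear_map scale \<nu>"
    using bilinear_map_scale_add[OF bilinear bil, of "1/2"] unfolding \<nu>[symmetric] .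
  have "\<nu> X Y - \<nu> Y X = (1/2) \<cdot> \<mu> X Y - (1/2) \<cdot> (- \<mu> X Y)"
    using bracket_skew[of Y X] sym[of X Y] by (simp add: \<nu>)
  also have "\<dots> = (1/2 + 1/2) \<cdot> \<mu> X Y"
    by (simp only: scale_minus_right scale_left_distrib diff_minus_eq_add)
  finally have commutator: "\<nu> X Y - \<nu> Y X = \<mu> X Y"
    by simp
  have right: "4 \<cdot> (\<nu> (\<nu> X Y) Z - \<nu> (\<nu> Y X) Z) = 2 \<cdot> \<mu> (\<mu> X Y) Z + 4 \<cdot> \<phi> (\<mu> X Y) Z"
    unfolding bilinear_map_diff_left[OF bil_\<nu>, symmetric] commutator
    by (simp add: \<nu> scale_right_distrib)
  have nested: "4 \<cdot> \<nu> U (\<nu> V Z) =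
      \<mu> U (\<mu> V Z) + 2 \<cdot> \<mu> U (\<phi> V Z) + 2 \<cdot> \<phi> U (\<mu> V Z) + 4 \<cdot> \<phi> U (\<phi> V Z)" for U V
    by (simp add: \<nu> bilinear_map_simps[OF bilinear] bilinear_map_simps[OF bil]
        scale_right_distrib add.assoc)
  have skew: "\<mu> (\<mu> Y X) Z = - \<mu> (\<mu> X Y) Z" "\<phi> (\<mu> Y X) Z = - \<phi> (\<mu> X Y) Z"
    using bracket_skew[of Y X]
    by (simp_all add: bilinear_map_minus_left[OF bilinear] bilinear_map_minus_left[OF bil])
  have double: "2 \<cdot> \<mu> (\<mu> X Y) Z = \<mu> (\<mu> X Y) Z + \<mu> (\<mu> X Y) Z"
    using scale_left_distrib[of 1 1 "\<mu> (\<mu> X Y) Z"] by simp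
  show ?thesis
    unfolding scale_right_diff_distrib[of 4 "_ - _" "_ - _"] right
    using jacobi_adjoint[of X Y Z]
    by (simp add: scale_right_diff_distrib nested skew double algebra_simps)
qed

theorem proposition6p2:
  fixes scale :: "'k::{alg_closed_field, field_char_0} \<Rightarrow> 'a::ab_group_add \<Rightarrow> 'a" (infixr \<open>\<cdot>\<close> 75)
    and Basis :: "'a set"
    and n :: nat
    and \<mu> \<phi> :: "'a \<Rightarrow> 'a \<Rightarrow> 'a"
  assumes "finite_dimensional_vector_space scale Basis"
    and "vector_space.dim scale UNIV = n"
    and "lie_algebra scale \<mu>"
    and "bilinear_map scale \<phi>"
    and "\<And>X Y. \<phi> X Y = \<phi> Y X"
  shows "vinberg_algebra scale (\<lambda>X Y. (1/2) \<cdot> \<mu> X Y + \<phi> X Y) \<longleftrightarrow>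
    (\<forall>X1 X2 X3.
        4 \<cdot> \<phi> (\<mu> X2 X1) X3 + 2 \<cdot> \<mu> X1 (\<phi> X2 X3) + 2 \<cdot> \<phi> X1 (\<mu> X2 X3)
      + 4 \<cdot> \<phi> X1 (\<phi> X2 X3) - 2 \<cdot> \<mu> X2 (\<phi> X1 X3) - 2 \<cdot> \<phi> X2 (\<mu> X1 X3)
      - 4 \<cdot> \<phi> X2 (\<phi> X1 X3) + \<mu> (\<mu> X2 X1) X3 = 0)"
proof -
  define \<nu> where "\<nu> = (\<lambda>X Y. (1/2) \<cdot> \<mu> X Y + \<phi> X Y)"
  interpret lie_algebra scale \<mu> by fact
  have bil_\<nu>: "bilinear_map scale \<nu>"
    unfolding \<nu>_def by (rule bilinear_map_scale_add[OF bilinear assms(4)])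
  have "vinberg_algebra scale \<nu> \<longleftrightarrow>
      (\<forall>X Y Z. \<nu> X (\<nu> Y Z) - \<nu> Y (\<nu> X Z) = \<nu> (\<nu> X Y) Z - \<nu> (\<nu> Y X) Z)"
    using vector_space_axioms bil_\<nu>
    by (auto simp: vinberg_algebra_def vinberg_algebra_axioms_def)
  also have "\<dots> \<longleftrightarrow>
      (\<forall>X Y Z. 4 \<cdot> ((\<nu> X (\<nu> Y Z) - \<nu> Y (\<nu> X Z)) - (\<nu> (\<nu> X Y) Z - \<nu> (\<nu> Y X) Z)) = 0)"
    by simp
  finally show ?thesis
    unfolding four_times_defect[OF assms(3-5) fun_cong[OF fun_cong[OF \<nu>_def]]]
    by (simp only: \<nu>_def)
qed

end
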